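(* Let $(\mathcal{X},\mathcal{F})$ be a measurable space. For any order $\alpha\in(0,\infty]$, $D_\alpha(P\|Q)$ is a lower semi-continuous function of the pair $(P,Q)$ of probability distributions on $(\mathcal{X},\mathcal{F})$ in the topology of setwise convergence.
   Context: The topology of setwise convergence on the set of probability distributions on $(\mathcal{X},\mathcal{F})$ is the coarsest topology such that, for every $A\in\mathcal{F}$, the function $P\mapsto P(A)$ is continuous; pairs $(P,Q)$ carry the product topology. Rényi divergence: let $P,Q$ have densities $p,q$ with respect to a dominating $\sigma$-finite measure $\mu$ (whose choice is immaterial). For $\alpha\in(0,1)\cup(1,\infty)$, $D_\alpha(P\|Q)=\frac{1}{\alpha-1}\ln\int p^\alpha q^{1-\alpha}\,d\mu\in[0,\infty]$, where for $\alpha>1$ one reads $p^\alpha q^{1-\alpha}$ as $p^\alpha/q^{\alpha-1}$ with the conventions $0/0=0$ and $x/0=\infty$ for $x>0$. Further $D_1(P\|Q)=\lim_{\alpha\uparrow1}D_\alpha(P\|Q)$ and $D_\infty(P\|Q)=\lim_{\alpha\uparrow\infty}D_\alpha(P\|Q)$ (these limits always exist in $[0,\infty]$). *)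

theory Defs
  imports "HOL-Probability.Probability"
begin


text \<open>
  The points are the probability measures on the measurable space \<open>(space M, sets M)\<close>;
  neither the measure carried by \<open>M\<close> nor the \<open>\<sigma>\<close>-algebra of \<^term>\<open>prob_algebra M\<close> plays a role.
\<close>

definition setwise_topology :: "'a measure \<Rightarrow> 'a measure topology" where
  "setwise_topology M = topology_generated_by
     {{P \<in> space (prob_algebra M). measure P A \<in> U} | A U. A \<in> sets M \<and> open U}"

lemma topspace_setwise_topology [simp]:
  "topspace (setwise_topology M) = space (prob_algebra M)"
proof -
  have "{P \<in> space (prob_algebra M). measure P {} \<in> UNIV} = space (prob_algebra M)" by simp
  then have "space (prob_algebra M) \<in>
      {{P \<in> space (prob_algebra M). measure P A \<in> U} | A U. A \<in> sets M \<and> open U}"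
    using open_UNIV sets.empty_sets by (intro CollectI exI[of _ "{}"] exI[of _ UNIV]) auto
  then show ?thesis unfolding setwise_topology_def by auto
qed

lemma continuous_map_setwise_topology:
  assumes "A \<in> sets M"
  shows "continuous_map (setwise_topology M) euclideanreal (\<lambda>P. measure P A)"
  unfolding continuous_map
proof safe
  fix U :: "real set" assume "openin euclideanreal U"
  then have "open U" by simp
  with assms show
    "openin (setwise_topology M) {P \<in> topspace (setwise_topology M). measure P A \<in> U}"
    unfolding topspace_setwise_topology
    unfolding setwise_topology_def by (intro topology_generated_by_Basis) blast
qed auto

lemma setwise_topology_coarsest:
  assumes "topspace T = space (prob_algebra M)"
    and "\<And>A. A \<in> sets M \<Longrightarrow> continuous_map T euclideanreal (\<lambda>P. measure P A)"
    and "openin (setwise_topology M) V"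
  shows "openin T V"
proof -
  have "generate_topology_on
      {{P \<in> space (prob_algebra M). measure P A \<in> U} | A U. A \<in> sets M \<and> open U} V"
    using assms(3) unfolding setwise_topology_def openin_topology_generated_by_iff .
  then show ?thesis
  proof induction
    case (Basis s)
    then obtain A U where "A \<in> sets M" "open U"
        "s = {P \<in> space (prob_algebra M). measure P A \<in> U}" by blast
    with assms(2)[of A] assms(1) show ?case by (auto simp: continuous_map)
  qed auto
qed

definition lower_semicontinuous_map :: "'b topology \<Rightarrow> ('b \<Rightarrow> ereal) \<Rightarrow> bool" where
  "lower_semicontinuous_map X f \<longleftrightarrow> (\<forall>a. openin X {x \<in> topspace X. a < f x})"



definition ln_ext :: "ennreal \<Rightarrow> ereal" where
  "ln_ext x = (if x = 0 then -\<infinity> else if x = \<infinity> then \<infinity> else ereal (ln (enn2real x)))"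

text \<open>
  Division in \<^typ>\<open>ennreal\<close> satisfies \<open>0 / 0 = 0\<close> and \<open>x / 0 = \<infinity>\<close> for \<open>x > 0\<close>, as required
  for \<open>\<alpha> > 1\<close>.
\<close>

definition renyi_integrand :: "real \<Rightarrow> real \<Rightarrow> real \<Rightarrow> ennreal" where
  "renyi_integrand \<alpha> p q =
     (if \<alpha> < 1 then ennreal (p powr \<alpha>) * ennreal (q powr (1 - \<alpha>))
      else ennreal (p powr \<alpha>) / ennreal (q powr (\<alpha> - 1)))"

definition renyi_of_densities ::
  "real \<Rightarrow> 'a measure \<Rightarrow> ('a \<Rightarrow> real) \<Rightarrow> ('a \<Rightarrow> real) \<Rightarrow> ereal" where
  "renyi_of_densities \<alpha> \<mu> p q =
     ereal (1 / (\<alpha> - 1)) * ln_ext (\<integral>\<^sup>+x. renyi_integrand \<alpha> (p x) (q x) \<partial>\<mu>)"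

definition measure_plus :: "'a measure \<Rightarrow> 'a measure \<Rightarrow> 'a measure" where
  "measure_plus P Q = measure_of (space P) (sets P) (\<lambda>A. emeasure P A + emeasure Q A)"

text \<open>
  The dominating measure is taken to be \<open>P + Q\<close>; lemma \<open>renyi_simple_eq_densities\<close> below shows
  that every \<open>\<sigma>\<close>-finite dominating measure and every choice of densities give the same value.
\<close>

definition renyi_simple :: "real \<Rightarrow> 'a measure \<Rightarrow> 'a measure \<Rightarrow> ereal" where
  "renyi_simple \<alpha> P Q =
     renyi_of_densities \<alpha> (measure_plus P Q)
       (\<lambda>x. enn2real (RN_deriv (measure_plus P Q) P x))
       (\<lambda>x. enn2real (RN_deriv (measure_plus P Q) Q x))"

definition renyi_divergence :: "ereal \<Rightarrow> 'a measure \<Rightarrow> 'a measure \<Rightarrow> ereal" where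
  "renyi_divergence \<alpha> P Q =
     (if \<alpha> = 1 then Lim (at_left 1) (\<lambda>a. renyi_simple a P Q)
      else if \<alpha> = \<infinity> then Lim at_top (\<lambda>a. renyi_simple a P Q)
      else renyi_simple (real_of_ereal \<alpha>) P Q)"

lemma
  shows space_measure_plus [simp]: "space (measure_plus P Q) = space P"
    and sets_measure_plus [simp, measurable_cong]: "sets (measure_plus P Q) = sets P"
  by (simp_all add: measure_plus_def)

lemma emeasure_measure_plus:
  assumes "sets Q = sets P" and "A \<in> sets P"
  shows "emeasure (measure_plus P Q) A = emeasure P A + emeasure Q A"
proof (rule emeasure_measure_of[OF measure_plus_def])
  show "countably_additive (sets (measure_plus P Q)) (\<lambda>A. emeasure P A + emeasure Q A)"
    unfolding countably_additive_def
  proof (intro allI impI)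
    fix B :: "nat \<Rightarrow> 'a set"
    assume B: "range B \<subseteq> sets (measure_plus P Q)" "disjoint_family B"
    with assms(1) have "range B \<subseteq> sets P" "range B \<subseteq> sets Q" by auto
    with B(2) show "(\<Sum>i. emeasure P (B i) + emeasure Q (B i)) =
        emeasure P (\<Union> (range B)) + emeasure Q (\<Union> (range B))"
      by (simp add: suminf_add[symmetric] suminf_emeasure)
  qed
  show "sets P \<subseteq> Pow (space P)" by (rule sets.space_closed)
  show "A \<in> sets (measure_plus P Q)" using assms by simp
qed (simp add: positive_def)

lemma renyi_integrand_scale:
  assumes "0 \<le> s" "0 \<le> p" "0 \<le> q"
  shows "ennreal s * renyi_integrand \<alpha> p q = renyi_integrand \<alpha> (s * p) (s * q)"
proof (cases "s = 0")
  case True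
  then show ?thesis by (simp add: renyi_integrand_def)
next
  case False
  with assms have s: "0 < s" by simp
  show ?thesis
  proof (cases "\<alpha> < 1")
    case True
    have "s powr \<alpha> * s powr (1 - \<alpha>) = s" using s by (simp add: powr_add[symmetric])
    moreover have "(s * p) powr \<alpha> * (s * q) powr (1 - \<alpha>) =
        (s powr \<alpha> * s powr (1 - \<alpha>)) * (p powr \<alpha> * q powr (1 - \<alpha>))"
      using assms by (simp only: powr_mult mult_ac)
    ultimately have "(s * p) powr \<alpha> * (s * q) powr (1 - \<alpha>) =
        s * (p powr \<alpha> * q powr (1 - \<alpha>))" by (simp only:)
    then show ?thesis using True assms
      unfolding renyi_integrand_def by (simp only: if_True ennreal_mult'[symmetric] powr_ge_zero)
  next
    case ge: False
    show ?thesis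
    proof (cases "q = 0")
      case q: True
      show ?thesis
      proof (cases "p = 0")
        case False
        with assms s have "0 < p powr \<alpha>" "0 < (s * p) powr \<alpha>" by simp_all
        with ge q s show ?thesis
          by (simp only: renyi_integrand_def if_False)
             (simp add: ennreal_divide_zero ennreal_mult_top ennreal_zero_divide)
      qed (use ge q in \<open>simp add: renyi_integrand_def\<close>)
    next
      case False
      with assms have q: "0 < q" by simp
      have "s powr \<alpha> / s powr (\<alpha> - 1) = s" using s by (simp add: powr_diff[symmetric])
      moreover have "(s * p) powr \<alpha> / (s * q) powr (\<alpha> - 1) =
          (s powr \<alpha> / s powr (\<alpha> - 1)) * (p powr \<alpha> / q powr (\<alpha> - 1))"
        using assms by (simp only: powr_mult times_divide_times_eq)
      ultimately have "(s * p) powr \<alpha> / (s * q) powr (\<alpha> - 1) =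
          s * (p powr \<alpha> / q powr (\<alpha> - 1))" by (simp only:)
      moreover have "0 < q powr (\<alpha> - 1)" "0 < (s * q) powr (\<alpha> - 1)" using s q by simp_all
      ultimately show ?thesis using ge assms unfolding renyi_integrand_def
        by (simp only: if_False divide_ennreal ennreal_mult'[symmetric] powr_ge_zero)
    qed
  qed
qed

lemma renyi_simple_eq_densities:
  fixes p q :: "'a \<Rightarrow> real"
  assumes mu: "sigma_finite_measure \<mu>"
    and P: "prob_space P" "P = density \<mu> (\<lambda>x. ennreal (p x))"
    and Q: "prob_space Q" "Q = density \<mu> (\<lambda>x. ennreal (q x))"
    and p: "p \<in> borel_measurable \<mu>" "\<And>x. 0 \<le> p x"
    and q: "q \<in> borel_measurable \<mu>" "\<And>x. 0 \<le> q x"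
  shows "renyi_simple \<alpha> P Q = renyi_of_densities \<alpha> \<mu> p q"
proof -
  interpret P: prob_space P by (rule P)
  interpret Q: prob_space Q by (rule Q)
  interpret mu: sigma_finite_measure \<mu> by (rule mu)
  note [measurable] = p(1) q(1)
  have sets: "sets P = sets \<mu>" "sets Q = sets \<mu>" by (simp_all add: P(2) Q(2))
  define \<nu> where "\<nu> = measure_plus P Q"
  have sets_nu [simp, measurable_cong]: "sets \<nu> = sets \<mu>" by (simp add: \<nu>_def sets)
  have nu: "emeasure \<nu> A = emeasure P A + emeasure Q A" if "A \<in> sets \<mu>" for A
    unfolding \<nu>_def by (rule emeasure_measure_plus) (use that sets in auto)
  have nu_dens: "\<nu> = density \<mu> (\<lambda>x. ennreal (p x + q x))"
  proof (rule measure_eqI)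
    fix A assume "A \<in> sets \<nu>"
    then have A [measurable]: "A \<in> sets \<mu>" by simp
    show "emeasure \<nu> A = emeasure (density \<mu> (\<lambda>x. ennreal (p x + q x))) A"
      unfolding nu[OF A] unfolding P(2) Q(2)
      by (simp add: emeasure_density nn_integral_add[symmetric] p q distrib_right)
  qed simp
  have "space P = space \<mu>" "space Q = space \<mu>" by (simp_all add: P(2) Q(2))
  moreover have "space \<nu> = space \<mu>" by (simp add: \<nu>_def P(2))
  ultimately have "emeasure \<nu> (space \<nu>) = 1 + 1"
    using nu[of "space \<mu>"] P.emeasure_space_1 Q.emeasure_space_1 by simp
  then interpret nu: finite_measure \<nu> by (intro finite_measureI) simp
  have *: "AE x in \<mu>. (p x + q x) * enn2real (RN_deriv \<nu> R x) = r x"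
    if R: "prob_space R" "R = density \<mu> (\<lambda>x. ennreal (r x))"
      and r [measurable]: "r \<in> borel_measurable \<mu>" and r0: "\<And>x. 0 \<le> r x"
      and le: "\<And>A. A \<in> sets \<mu> \<Longrightarrow> emeasure R A \<le> emeasure \<nu> A" for R r
  proof -
    interpret R: prob_space R by (rule R)
    have sR: "sets R = sets \<nu>" by (simp add: R(2))
    have ac: "absolutely_continuous \<nu> R"
      unfolding absolutely_continuous_def null_sets_def using le sR by fastforce
    have fin: "AE x in \<nu>. RN_deriv \<nu> R x \<noteq> \<infinity>"
      by (rule nu.RN_deriv_finite[OF R.sigma_finite_measure_axioms ac sR])
    have [measurable]: "RN_deriv \<nu> R \<in> borel_measurable \<mu>"
      using borel_measurable_RN_deriv[of \<nu> R] by (simp cong: measurable_cong_sets)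
    have "R = density \<nu> (RN_deriv \<nu> R)" using nu.density_RN_deriv[OF ac sR] by simp
    also have "\<dots> = density \<nu> (\<lambda>x. ennreal (enn2real (RN_deriv \<nu> R x)))"
      by (rule density_cong) (use fin in \<open>auto simp: less_top\<close>)
    also have "\<dots> = density \<mu> (\<lambda>x. ennreal (p x + q x) * ennreal (enn2real (RN_deriv \<nu> R x)))"
      by (subst nu_dens) (simp add: density_density_eq)
    also have "(\<lambda>x. ennreal (p x + q x) * ennreal (enn2real (RN_deriv \<nu> R x))) =
        (\<lambda>x. ennreal ((p x + q x) * enn2real (RN_deriv \<nu> R x)))"
      by (simp add: ennreal_mult p q)
    finally have "density \<mu> (\<lambda>x. ennreal ((p x + q x) * enn2real (RN_deriv \<nu> R x))) =
        density \<mu> (\<lambda>x. ennreal (r x))" using R(2) by simp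
    then have "AE x in \<mu>. ennreal ((p x + q x) * enn2real (RN_deriv \<nu> R x)) = ennreal (r x)"
      by (subst (asm) mu.density_unique_iff) auto
    then show ?thesis by eventually_elim (simp add: p q r0)
  qed
  define p' q' where "p' = (\<lambda>x. enn2real (RN_deriv \<nu> P x))"
    and "q' = (\<lambda>x. enn2real (RN_deriv \<nu> Q x))"
  have p': "AE x in \<mu>. (p x + q x) * p' x = p x"
    unfolding p'_def by (rule *[OF P p]) (simp add: nu)
  have q': "AE x in \<mu>. (p x + q x) * q' x = q x"
    unfolding q'_def by (rule *[OF Q q]) (simp add: nu)
  have [measurable]: "p' \<in> borel_measurable \<mu>" "q' \<in> borel_measurable \<mu>"
    unfolding p'_def q'_def
    using borel_measurable_RN_deriv[of \<nu> P] borel_measurable_RN_deriv[of \<nu> Q]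
    by (simp_all cong: measurable_cong_sets)
  have [measurable]: "(\<lambda>x. renyi_integrand \<alpha> (p' x) (q' x)) \<in> borel_measurable \<mu>"
    unfolding renyi_integrand_def by measurable
  have "(\<integral>\<^sup>+x. renyi_integrand \<alpha> (p' x) (q' x) \<partial>\<nu>) =
      (\<integral>\<^sup>+x. ennreal (p x + q x) * renyi_integrand \<alpha> (p' x) (q' x) \<partial>\<mu>)"
    unfolding nu_dens by (subst nn_integral_density) auto
  also have "\<dots> = (\<integral>\<^sup>+x. renyi_integrand \<alpha> ((p x + q x) * p' x) ((p x + q x) * q' x) \<partial>\<mu>)"
    by (intro nn_integral_cong renyi_integrand_scale) (auto simp: p q p'_def q'_def)
  also have "\<dots> = (\<integral>\<^sup>+x. renyi_integrand \<alpha> (p x) (q x) \<partial>\<mu>)"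
    by (intro nn_integral_cong_AE, use p' q' in eventually_elim, simp only:)
  finally show ?thesis
    unfolding renyi_simple_def renyi_of_densities_def \<nu>_def[symmetric]
    unfolding p'_def q'_def by simp
qed

end

theory Submission
  imports Defs
begin

text \<open>
  For fixed \<open>\<alpha> \<noteq> 1\<close>, the tangent line of \<open>x \<mapsto> x\<^sup>\<alpha>\<close> at \<open>t\<close>, evaluated at \<open>p / q\<close>, gives
  \<open>\<alpha> t\<^sup>\<alpha>\<^sup>-\<^sup>1 p + (1 - \<alpha>) t\<^sup>\<alpha> q\<close>, which lies above \<open>p\<^sup>\<alpha> q\<^sup>1\<^sup>-\<^sup>\<alpha>\<close> for \<open>\<alpha> < 1\<close> and below it for
  \<open>\<alpha> > 1\<close>, with equality at \<open>t = p / q\<close>. Letting \<open>t\<close> range over functions for which the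
  coefficients of \<open>p\<close> and \<open>q\<close> are bounded, \<open>\<integral> p\<^sup>\<alpha> q\<^sup>1\<^sup>-\<^sup>\<alpha>\<close> becomes an infimum, respectively a supremum,
  of functionals \<open>\<integral> u dP + \<integral> v dQ\<close> with \<open>u\<close> and \<open>v\<close> bounded, and these are continuous for setwise
  convergence. Since the divergence increases with \<open>\<alpha>\<close>, the extended orders \<open>1\<close> and \<open>\<infinity>\<close> are
  suprema of simple orders.
\<close>

section \<open>Integrals of bounded functions under setwise convergence\<close>

text \<open>For a simple function the integral is a finite linear combination of measures of level
  sets, each continuous by the choice of topology.\<close>

lemma continuous_map_setwise_integral_simple:
  fixes u :: "'a \<Rightarrow> real"
  assumes u: "simple_function M u"
  shows "continuous_map (setwise_topology M) euclideanreal (\<lambda>P. \<integral>x. u x \<partial>P)"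
proof -
  have [measurable]: "u \<in> borel_measurable M" using u by (rule borel_measurable_simple_function)
  have "continuous_map (setwise_topology M) euclideanreal
      (\<lambda>P. \<Sum>y\<in>u ` space M. measure P {x\<in>space M. u x = y} * y)"
    using simple_functionD(1)[OF u]
    by (intro continuous_map_sum continuous_map_real_mult continuous_map_setwise_topology) auto
  moreover have "(\<Sum>y\<in>u ` space M. measure P {x\<in>space M. u x = y} * y) = (\<integral>x. u x \<partial>P)"
    if "P \<in> topspace (setwise_topology M)" for P
  proof -
    have sets: "sets P = sets M" and "prob_space P"
      using that by (simp_all add: space_prob_algebra)
    then interpret prob_space P by simp
    have space: "space P = space M" using sets by (rule sets_eq_imp_space_eq)
    have "simple_function P u" using u unfolding simple_function_def sets space .
    then have "Bochner_Integration.simple_bochner_integrable P u"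
      by (rule simple_bochner_integrable.intros) simp
    from simple_bochner_integrable_eq_integral[OF this] show ?thesis
      by (simp add: simple_bochner_integral_def space)
  qed
  ultimately show ?thesis by (rule continuous_map_eq)
qed

text \<open>All the measures have mass one, so uniform approximation of \<open>u\<close> by simple
  functions approximates the integrals uniformly in \<open>P\<close>, and uniform limits of
  continuous maps are continuous. Boundedness of \<open>u\<close> keeps the approximants finitely
  valued.\<close>

lemma continuous_map_setwise_integral:
  fixes u :: "'a \<Rightarrow> real"
  assumes u [measurable]: "u \<in> borel_measurable M"
    and B: "\<And>x. x \<in> space M \<Longrightarrow> \<bar>u x\<bar> \<le> B"
  shows "continuous_map (setwise_topology M) euclideanreal (\<lambda>P. \<integral>x. u x \<partial>P)"
proof -
  \<comment> \<open>Rounding down to multiples of \<open>1 / (n + 1)\<close> gives simple functions converging uniformly.\<close>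
  define v where "v n x = of_int \<lfloor>real (Suc n) * u x\<rfloor> / real (Suc n)" for n x
  have v [measurable]: "v n \<in> borel_measurable M" for n unfolding v_def by measurable
  have v_le: "v n x \<le> u x" and v_ge: "u x \<le> v n x + 1 / real (Suc n)" for n x
    unfolding v_def by (simp_all add: field_simps, linarith+)
  have fin: "finite (v n ` space M)" for n
  proof (rule finite_subset)
    show "v n ` space M \<subseteq> (\<lambda>k. of_int k / real (Suc n)) `
        {\<lfloor>real (Suc n) * (-B)\<rfloor>..\<lfloor>real (Suc n) * B\<rfloor>}"
    proof safe
      fix x assume "x \<in> space M"
      from B[OF this] have "-B \<le> u x" "u x \<le> B" by auto
      then have "\<lfloor>real (Suc n) * (-B)\<rfloor> \<le> \<lfloor>real (Suc n) * u x\<rfloor>"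
          "\<lfloor>real (Suc n) * u x\<rfloor> \<le> \<lfloor>real (Suc n) * B\<rfloor>"
        by (intro floor_mono mult_left_mono; simp)+
      then show "v n x \<in> (\<lambda>k. of_int k / real (Suc n)) `
          {\<lfloor>real (Suc n) * (-B)\<rfloor>..\<lfloor>real (Suc n) * B\<rfloor>}"
        unfolding v_def by (intro imageI) auto
    qed
  qed simp
  have simple: "simple_function M (v n)" for n
    unfolding simple_function_def
  proof (intro conjI ballI fin)
    fix y show "v n -` {y} \<inter> space M \<in> sets M" by measurable
  qed
  have close: "dist (\<integral>x. v n x \<partial>P) (\<integral>x. u x \<partial>P) \<le> 1 / real (Suc n)"
    if "P \<in> topspace (setwise_topology M)" for n P
  proof -
    have sets [measurable_cong]: "sets P = sets M" and "prob_space P"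
      using that by (simp_all add: space_prob_algebra)
    then interpret prob_space P by simp
    have space: "space P = space M" using sets by (rule sets_eq_imp_space_eq)
    have iu: "integrable P u"
      by (rule integrable_const_bound[where B=B]) (auto simp: B space)
    \<comment> \<open>Rounding moves \<open>u\<close> by at most 1, whence the bound
      \<open>B + 1\<close>.\<close>
    have iv: "integrable P (v n)"
    proof (rule integrable_const_bound[where B="B + 1"])
      show "AE x in P. norm (v n x) \<le> B + 1"
      proof (rule AE_I2)
        fix x assume "x \<in> space P"
        moreover have "1 / real (Suc n) \<le> 1" by simp
        ultimately show "norm (v n x) \<le> B + 1" using v_le[of n x] v_ge[of x n] B[of x]
          unfolding real_norm_def space by linarith
      qed
    qed simp
    have "(\<integral>x. v n x \<partial>P) \<le> (\<integral>x. u x \<partial>P)" using iv iu v_le by (rule integral_mono)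
    moreover have "(\<integral>x. u x \<partial>P) \<le> (\<integral>x. v n x + 1 / real (Suc n) \<partial>P)"
      using iu iv v_ge by (intro integral_mono) auto
    moreover have "\<dots> = (\<integral>x. v n x \<partial>P) + 1 / real (Suc n)"
      using iv by (simp add: prob_space)
    ultimately show ?thesis unfolding dist_real_def by linarith
  qed
  have "\<forall>\<^sub>F n in sequentially. \<forall>P\<in>topspace (setwise_topology M).
      (\<integral>x. u x \<partial>P) \<in> UNIV \<and> dist (\<integral>x. v n x \<partial>P) (\<integral>x. u x \<partial>P) < \<epsilon>" if "0 < \<epsilon>" for \<epsilon>
    using order_tendstoD(2)[OF LIMSEQ_inverse_real_of_nat that]
    by eventually_elim (auto simp: inverse_eq_divide intro: le_less_trans[OF close])
  then show ?thesis
    using Met_TC.continuous_map_uniform_limit[where F = sequentially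
        and X = "setwise_topology M" and f = "\<lambda>n P. \<integral>x. v n x \<partial>P"
        and g = "\<lambda>P. \<integral>x. u x \<partial>P"]
      continuous_map_setwise_integral_simple[OF simple]
    by simp
qed

section \<open>Monotonicity in the order\<close>

text \<open>Young's inequality for \<open>t powr (\<theta> - 1) * x\<close> and
  \<open>t powr \<theta> * y\<close>; the powers of \<open>t\<close> cancel in the geometric mean.
  The right side is the tangent plane touching along \<open>x = t * y\<close>, and \<open>t\<close>
  is left free so that it can be optimized.\<close>

lemma powr_interpolate_le:
  fixes x y \<theta> t :: real
  assumes "0 < \<theta>" "\<theta> < 1" "0 \<le> x" "0 \<le> y" "0 < t"
  shows "x powr \<theta> * y powr (1 - \<theta>) \<le> \<theta> * t powr (\<theta> - 1) * x + (1 - \<theta>) * t powr \<theta> * y"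
proof (cases "x = 0 \<or> y = 0")
  case False
  have "(t powr (\<theta> - 1) * x) powr \<theta> * (t powr \<theta> * y) powr (1 - \<theta>) =
      t powr ((\<theta> - 1) * \<theta> + \<theta> * (1 - \<theta>)) * (x powr \<theta> * y powr (1 - \<theta>))"
    using assms by (simp add: powr_mult powr_powr powr_add)
  also have "(\<theta> - 1) * \<theta> + \<theta> * (1 - \<theta>) = 0" by (simp add: algebra_simps)
  finally show ?thesis
    using Youngs_inequality_0[of \<theta> "1 - \<theta>" "t powr (\<theta> - 1) * x" "t powr \<theta> * y"] assms False
    by (simp add: mult.assoc)
qed (use assms in auto)

lemma ln_ext_ennreal: "0 < r \<Longrightarrow> ln_ext (ennreal r) = ereal (ln r)"
  by (simp add: ln_ext_def)

text \<open>The threshold \<open>c\<close> is the extended exponential of \<open>y\<close>, equal to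
  0 and \<infinity> at the two ends. It turns strict sub- and superlevel sets of
  \<open>ln_ext\<close> into those of its argument.\<close>

lemma ln_ext_less_iff:
  obtains c where "\<And>x. y < ln_ext x \<longleftrightarrow> c < x" "\<And>x. ln_ext x < y \<longleftrightarrow> x < c"
proof (cases y)
  case (real r)
  have "(y < ln_ext x \<longleftrightarrow> ennreal (exp r) < x) \<and> (ln_ext x < y \<longleftrightarrow> x < ennreal (exp r))" for x
  proof (cases x)
    case (real s)
    then show ?thesis
    proof (cases "s = 0")
      case False
      with real have s: "0 < s" by simp
      have "r < ln s \<longleftrightarrow> exp r < s" "ln s < r \<longleftrightarrow> s < exp r"
        using s by (metis exp_less_cancel_iff exp_ln)+
      then show ?thesis using s by (simp add: real \<open>y = ereal r\<close> ln_ext_ennreal ennreal_less_iff)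
    qed (simp add: \<open>y = ereal r\<close> ln_ext_def)
  qed (simp add: \<open>y = ereal r\<close> ln_ext_def)
  then show thesis using that by blast
next
  case PInf
  then show thesis using that[of \<infinity>] by (auto simp: ln_ext_def less_top)
next
  case MInf
  then show thesis using that[of 0] by (auto simp: ln_ext_def zero_less_iff_neq_zero)
qed

lemma ln_ext_mono:
  assumes "x \<le> y"
  shows "ln_ext x \<le> ln_ext y"
proof -
  obtain c where "\<And>z. ln_ext z < ln_ext x \<longleftrightarrow> z < c" using ln_ext_less_iff by metis
  with assms show ?thesis by (meson le_less_trans less_irrefl not_le)
qed

text \<open>A logarithmic form of Hoelder's inequality with a weight \<open>w\<close> of mass one:
  integrate the bound for each \<open>t\<close>, then optimize over \<open>t\<close>. Assuming a
  family of linear bounds avoids real powers of possibly infinite values of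
  \<open>f\<close>.\<close>

lemma ln_ext_nn_integral_interpolate:
  fixes f g w :: "'a \<Rightarrow> ennreal"
  assumes \<theta>: "0 < \<theta>" "\<theta> < 1"
    and [measurable]: "f \<in> borel_measurable M" "w \<in> borel_measurable M"
    and w: "(\<integral>\<^sup>+x. w x \<partial>M) = 1"
    and le: "\<And>t x. 0 < t \<Longrightarrow> x \<in> space M \<Longrightarrow>
      g x \<le> ennreal (\<theta> * t powr (\<theta> - 1)) * f x + ennreal ((1 - \<theta>) * t powr \<theta>) * w x"
  shows "ln_ext (\<integral>\<^sup>+x. g x \<partial>M) \<le> ereal \<theta> * ln_ext (\<integral>\<^sup>+x. f x \<partial>M)"
proof -
  define F where "F = (\<integral>\<^sup>+x. f x \<partial>M)"
  have bound: "(\<integral>\<^sup>+x. g x \<partial>M) \<le> ennreal (\<theta> * t powr (\<theta> - 1)) * F + ennreal ((1 - \<theta>) * t powr \<theta>)"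
    if "0 < t" for t
  proof -
    have "(\<integral>\<^sup>+x. g x \<partial>M) \<le>
        (\<integral>\<^sup>+x. ennreal (\<theta> * t powr (\<theta> - 1)) * f x + ennreal ((1 - \<theta>) * t powr \<theta>) * w x \<partial>M)"
      using le[OF that] by (intro nn_integral_mono)
    then show ?thesis by (simp add: nn_integral_add nn_integral_cmult w F_def)
  qed
  show ?thesis
  proof (cases F)
    case (real r)
    show ?thesis
    proof (cases "r = 0")
      case True
      \<comment> \<open>Let \<open>t\<close> tend to \<open>0\<close>; for \<open>r > 0\<close> the optimal choice is \<open>t = r\<close>.\<close>
      have "(\<integral>\<^sup>+x. g x \<partial>M) \<le> 0"
      proof (rule ennreal_le_epsilon)
        fix e :: real assume e: "0 < e"
        have "(\<integral>\<^sup>+x. g x \<partial>M) \<le> ennreal ((1 - \<theta>) * e)"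
          using bound[of "e powr (1 / \<theta>)"] e \<theta> by (simp add: real True powr_powr)
        also have "\<dots> \<le> ennreal e" using e \<theta> by (intro ennreal_leI) (simp add: algebra_simps)
        finally show "(\<integral>\<^sup>+x. g x \<partial>M) \<le> 0 + ennreal e" by simp
      qed
      then show ?thesis by (simp add: ln_ext_def)
    next
      case False
      with real have r: "0 < r" by simp
      have "(\<integral>\<^sup>+x. g x \<partial>M) \<le> ennreal (\<theta> * r powr (\<theta> - 1) * r + (1 - \<theta>) * r powr \<theta>)"
        using bound[OF r] r \<theta> by (simp add: real ennreal_mult[symmetric] ennreal_plus[symmetric]
            del: ennreal_plus)
      also have "\<theta> * r powr (\<theta> - 1) * r + (1 - \<theta>) * r powr \<theta> = r powr \<theta>"
        using r by (simp add: powr_diff algebra_simps)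
      finally show ?thesis
        using ln_ext_mono[of "\<integral>\<^sup>+x. g x \<partial>M" "ennreal (r powr \<theta>)"] r
        unfolding F_def[symmetric] real by (simp add: ln_ext_ennreal)
    qed
  next
    case top
    then show ?thesis using \<theta> by (simp add: ln_ext_def F_def[symmetric])
  qed
qed

text \<open>The order \<open>\<gamma>\<close> is the convex combination of \<open>\<delta>\<close>
  and 1 with weights \<open>\<theta>\<close> and \<open>1 - \<theta>\<close>. Hence the integrand at
  \<open>\<gamma>\<close> factors as that at \<open>\<delta>\<close> to the power
  \<open>\<theta>\<close> times \<open>p powr (1 - \<theta>)\<close>, and Young's inequality
  applies. Where \<open>q = 0 < p\<close> and \<open>\<delta> > 1\<close>, the right side is
  infinite.\<close>

lemma renyi_integrand_interpolate:
  assumes \<theta>: "0 < \<theta>" "\<theta> < 1" and \<gamma>: "\<gamma> - 1 = \<theta> * (\<delta> - 1)" and \<delta>: "0 < \<delta>" "\<delta> \<noteq> 1"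
    and pq: "0 \<le> p" "0 \<le> q" and t: "0 < t"
  shows "renyi_integrand \<gamma> p q \<le>
    ennreal (\<theta> * t powr (\<theta> - 1)) * renyi_integrand \<delta> p q + ennreal ((1 - \<theta>) * t powr \<theta>) * ennreal p"
proof -
  have \<gamma>_eq: "\<gamma> = \<delta> * \<theta> + (1 - \<theta>)" and "\<gamma> - 1 = (\<delta> - 1) * \<theta>" and "1 - \<gamma> = (1 - \<delta>) * \<theta>"
    using \<gamma> by (simp_all add: algebra_simps)
  have real: "ennreal z \<le>
      ennreal (\<theta> * t powr (\<theta> - 1)) * ennreal y + ennreal ((1 - \<theta>) * t powr \<theta>) * ennreal p"
    if "z = y powr \<theta> * p powr (1 - \<theta>)" "0 \<le> y" for y z
    using powr_interpolate_le[OF \<theta> \<open>0 \<le> y\<close> pq(1) t] that \<theta> pq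
    by (simp add: ennreal_mult[symmetric] ennreal_plus[symmetric] ennreal_leI del: ennreal_plus)
  show ?thesis
  proof (cases "\<delta> < 1")
    case True
    then have "\<theta> * (\<delta> - 1) < 0" using \<theta> by (intro mult_pos_neg) auto
    then have "\<gamma> < 1" using \<gamma> by simp
    moreover have "p powr \<gamma> * q powr (1 - \<gamma>) = (p powr \<delta> * q powr (1 - \<delta>)) powr \<theta> * p powr (1 - \<theta>)"
      unfolding \<open>1 - \<gamma> = _\<close> unfolding \<gamma>_eq using pq by (simp add: powr_mult powr_powr powr_add)
    ultimately show ?thesis
      using real True by (simp add: renyi_integrand_def ennreal_mult[symmetric])
  next
    case False
    with \<delta> have \<delta>: "1 < \<delta>" by simp
    then have "0 < \<theta> * (\<delta> - 1)" using \<theta> by simp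
    then have \<gamma>1: "1 < \<gamma>" using \<gamma> by simp
    show ?thesis
    proof (cases "q = 0")
      case True
      then show ?thesis
      proof (cases "p = 0")
        case False
        then have "renyi_integrand \<delta> p q = top"
          using True \<delta> pq by (simp add: renyi_integrand_def ennreal_divide_zero)
        then show ?thesis using \<theta> t by (simp add: ennreal_mult_top)
      qed (use \<gamma>1 in \<open>simp add: renyi_integrand_def\<close>)
    next
      case False
      with pq have q: "0 < q" by simp
      have "p powr \<gamma> / q powr (\<gamma> - 1) = (p powr \<delta> / q powr (\<delta> - 1)) powr \<theta> * p powr (1 - \<theta>)"
        unfolding \<open>\<gamma> - 1 = (\<delta> - 1) * \<theta>\<close> unfolding \<gamma>_eq using pq
        by (simp add: powr_divide powr_powr powr_add)
      then show ?thesis using real \<delta> \<gamma>1 q pq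
        by (simp add: renyi_integrand_def divide_ennreal)
    qed
  qed
qed

lemma ereal_mult_left_antimono:
  assumes "c < 0" "x \<le> y"
  shows "ereal c * y \<le> ereal c * x"
  using ereal_mult_left_mono[of x y "ereal (- c)"] assms
  by (simp flip: uminus_ereal.simps)

text \<open>Setwise domination gives absolute continuity, and the derivative is finite almost
  everywhere, so its real-valued version still represents \<open>R\<close>.\<close>

lemma density_RN_deriv_of_le:
  assumes "finite_measure N" "finite_measure R" and sets: "sets R = sets N"
    and le: "\<And>A. A \<in> sets N \<Longrightarrow> emeasure R A \<le> emeasure N A"
  shows "density N (\<lambda>x. ennreal (enn2real (RN_deriv N R x))) = R"
proof -
  interpret N: finite_measure N by fact
  interpret R: finite_measure R by fact
  have ac: "absolutely_continuous N R"
    unfolding absolutely_continuous_def null_sets_def using le sets by fastforce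
  have "AE x in N. RN_deriv N R x \<noteq> \<infinity>"
    by (rule N.RN_deriv_finite[OF R.sigma_finite_measure_axioms ac sets])
  then have "density N (\<lambda>x. ennreal (enn2real (RN_deriv N R x))) = density N (RN_deriv N R)"
    by (intro density_cong) (auto simp: less_top)
  then show ?thesis using N.density_RN_deriv[OF ac sets] by simp
qed

text \<open>The Hellinger-type integral inside the logarithm. It is isolated because the sign of
  \<open>\<alpha> - 1\<close> decides which of its level sets have to be open.\<close>

definition renyi_integral :: "real \<Rightarrow> 'a measure \<Rightarrow> 'a measure \<Rightarrow> ennreal" where
  "renyi_integral \<alpha> P Q = (\<integral>\<^sup>+x. renyi_integrand \<alpha>
     (enn2real (RN_deriv (measure_plus P Q) P x))
     (enn2real (RN_deriv (measure_plus P Q) Q x)) \<partial>measure_plus P Q)"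

lemma renyi_simple_eq:
  "renyi_simple \<alpha> P Q = ereal (1 / (\<alpha> - 1)) * ln_ext (renyi_integral \<alpha> P Q)"
  unfolding renyi_simple_def renyi_of_densities_def renyi_integral_def ..

section \<open>Densities of a pair of probability measures, and log-convexity in the order\<close>

locale prob_space_pair = P: prob_space P + Q: prob_space Q for P Q :: "'a measure" +
  assumes sets_Q: "sets Q = sets P"
begin

abbreviation \<mu> :: "'a measure" where "\<mu> \<equiv> measure_plus P Q"

definition p :: "'a \<Rightarrow> real" where "p x = enn2real (RN_deriv \<mu> P x)"

definition q :: "'a \<Rightarrow> real" where "q x = enn2real (RN_deriv \<mu> Q x)"

lemma measurable_densities [measurable]: "p \<in> borel_measurable P" "q \<in> borel_measurable P"
  unfolding p_def q_def
  using borel_measurable_RN_deriv[of \<mu> P] borel_measurable_RN_deriv[of \<mu> Q]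
  by (simp_all cong: measurable_cong_sets)

lemma nonneg [simp]: "0 \<le> p x" "0 \<le> q x"
  by (simp_all add: p_def q_def)

lemma finite_measure_plus: "finite_measure \<mu>"
  by (rule finite_measureI)
    (simp add: emeasure_measure_plus[OF sets_Q] Q.emeasure_finite)

lemma density_p: "density \<mu> (\<lambda>x. ennreal (p x)) = P"
  unfolding p_def
  by (rule density_RN_deriv_of_le[OF finite_measure_plus P.finite_measure_axioms])
    (simp_all add: emeasure_measure_plus[OF sets_Q])

lemma density_q: "density \<mu> (\<lambda>x. ennreal (q x)) = Q"
  unfolding q_def
  by (rule density_RN_deriv_of_le[OF finite_measure_plus Q.finite_measure_axioms])
    (simp_all add: emeasure_measure_plus[OF sets_Q] sets_Q)

lemma nn_integral_p: "(\<integral>\<^sup>+x. ennreal (p x) \<partial>\<mu>) = 1"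
proof -
  have "emeasure (density \<mu> (\<lambda>x. ennreal (p x))) (space P) = (\<integral>\<^sup>+x. ennreal (p x) \<partial>\<mu>)"
    by (subst emeasure_density) (auto intro!: nn_integral_cong)
  then show ?thesis by (simp add: density_p P.emeasure_space_1)
qed

lemma renyi_integral_eq: "renyi_integral \<alpha> P Q = (\<integral>\<^sup>+x. renyi_integrand \<alpha> (p x) (q x) \<partial>\<mu>)"
  by (simp add: renyi_integral_def p_def q_def)

lemma measurable_renyi_integrand [measurable]:
  "(\<lambda>x. renyi_integrand \<alpha> (p x) (q x)) \<in> borel_measurable P"
  unfolding renyi_integrand_def by measurable

text \<open>Log-convexity in the order between \<open>\<delta>\<close> and 1. The role of order 1 is
  played by \<open>p\<close>, whose integral is one and so contributes no logarithmic term.\<close>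

lemma ln_ext_renyi_integral_le:
  assumes "0 < \<theta>" "\<theta> < 1" "\<gamma> - 1 = \<theta> * (\<delta> - 1)" "0 < \<delta>" "\<delta> \<noteq> 1"
  shows "ln_ext (renyi_integral \<gamma> P Q) \<le> ereal \<theta> * ln_ext (renyi_integral \<delta> P Q)"
  unfolding renyi_integral_eq
  by (rule ln_ext_nn_integral_interpolate[OF assms(1,2) _ _ nn_integral_p])
    (use renyi_integrand_interpolate[OF assms] in auto)

text \<open>Here \<open>\<beta>\<close> lies between \<open>\<alpha>\<close> and 1, which determines
  \<open>\<theta>\<close>. Dividing the log-convexity bound by the negative number
  \<open>\<beta> - 1\<close> reverses it.\<close>

lemma renyi_simple_mono_less_1:
  assumes "0 < \<alpha>" "\<alpha> \<le> \<beta>" "\<beta> < 1"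
  shows "renyi_simple \<alpha> P Q \<le> renyi_simple \<beta> P Q"
proof (cases "\<alpha> = \<beta>")
  case False
  define \<theta> where "\<theta> = (1 - \<beta>) / (1 - \<alpha>)"
  have \<theta>: "0 < \<theta>" "\<theta> < 1" "\<beta> - 1 = \<theta> * (\<alpha> - 1)" using assms False by (simp_all add: \<theta>_def field_simps)
  have "ln_ext (renyi_integral \<beta> P Q) \<le> ereal \<theta> * ln_ext (renyi_integral \<alpha> P Q)"
    using ln_ext_renyi_integral_le[OF \<theta>] assms by simp
  then have "ereal (1 / (\<beta> - 1)) * (ereal \<theta> * ln_ext (renyi_integral \<alpha> P Q)) \<le>
      ereal (1 / (\<beta> - 1)) * ln_ext (renyi_integral \<beta> P Q)"
    using assms by (intro ereal_mult_left_antimono) auto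
  moreover have "1 / (\<beta> - 1) * \<theta> = 1 / (\<alpha> - 1)" using \<theta> assms by (simp add: field_simps)
  ultimately show ?thesis
    unfolding renyi_simple_eq mult.assoc[symmetric] times_ereal.simps by metis
qed simp

text \<open>Now \<open>\<alpha>\<close> lies between 1 and \<open>\<beta>\<close>, and the positive
  factor \<open>1 / (\<alpha> - 1)\<close> preserves the log-convexity bound.\<close>

lemma renyi_simple_mono_greater_1:
  assumes "1 < \<alpha>" "\<alpha> \<le> \<beta>"
  shows "renyi_simple \<alpha> P Q \<le> renyi_simple \<beta> P Q"
proof (cases "\<alpha> = \<beta>")
  case False
  define \<theta> where "\<theta> = (\<alpha> - 1) / (\<beta> - 1)"
  have \<theta>: "0 < \<theta>" "\<theta> < 1" "\<alpha> - 1 = \<theta> * (\<beta> - 1)" using assms False by (simp_all add: \<theta>_def field_simps)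
  have "ln_ext (renyi_integral \<alpha> P Q) \<le> ereal \<theta> * ln_ext (renyi_integral \<beta> P Q)"
    using ln_ext_renyi_integral_le[OF \<theta>] assms by simp
  then have "ereal (1 / (\<alpha> - 1)) * ln_ext (renyi_integral \<alpha> P Q) \<le>
      ereal (1 / (\<alpha> - 1)) * (ereal \<theta> * ln_ext (renyi_integral \<beta> P Q))"
    using assms by (intro ereal_mult_left_mono) auto
  moreover have "1 / (\<alpha> - 1) * \<theta> = 1 / (\<beta> - 1)" using \<theta> assms by (simp add: field_simps)
  ultimately show ?thesis
    unfolding renyi_simple_eq mult.assoc[symmetric] times_ereal.simps by metis
qed simp

end

section \<open>Tangent functionals\<close>

text \<open>Convexity replaces concavity, but the bound still follows from Young's inequality:
  \<open>p * t powr (\<alpha> - 1)\<close> is the geometric mean of \<open>A\<close> and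
  \<open>B\<close> with weights \<open>1 / \<alpha>\<close> and \<open>1 - 1 / \<alpha>\<close>.
  Multiply by \<open>\<alpha>\<close> and solve for \<open>A\<close>.\<close>

lemma powr_extrapolate_ge:
  fixes p q \<alpha> t :: real
  assumes "1 < \<alpha>" "0 \<le> p" "0 < q" "0 \<le> t"
  shows "\<alpha> * t powr (\<alpha> - 1) * p + (1 - \<alpha>) * t powr \<alpha> * q \<le> p powr \<alpha> / q powr (\<alpha> - 1)"
proof -
  define A B where "A = p powr \<alpha> / q powr (\<alpha> - 1)" and "B = t powr \<alpha> * q"
  have "A powr (1 / \<alpha>) * B powr (1 - 1 / \<alpha>) =
      p * t powr (\<alpha> - 1) * (q powr (1 - 1 / \<alpha>) / q powr ((\<alpha> - 1) / \<alpha>))"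
    using assms unfolding A_def B_def
    by (simp add: powr_mult powr_divide powr_powr right_diff_distrib)
  also have "(\<alpha> - 1) / \<alpha> = 1 - 1 / \<alpha>" using assms by (simp add: field_simps)
  finally have "A powr (1 / \<alpha>) * B powr (1 - 1 / \<alpha>) = p * t powr (\<alpha> - 1)"
    using assms by simp
  moreover have "A powr (1 / \<alpha>) * B powr (1 - 1 / \<alpha>) \<le> 1 / \<alpha> * A + (1 - 1 / \<alpha>) * B"
    using powr_interpolate_le[of "1 / \<alpha>" A B 1] assms by (simp add: A_def B_def)
  ultimately have "\<alpha> * (p * t powr (\<alpha> - 1)) \<le> \<alpha> * (1 / \<alpha> * A + (1 - 1 / \<alpha>) * B)"
    using assms by (intro mult_left_mono) auto
  also have "\<dots> = A + (\<alpha> - 1) * B" using assms by (simp add: field_simps)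
  finally show ?thesis by (simp add: A_def B_def algebra_simps)
qed

lemma tangent_powr_eq:
  fixes p q \<alpha> :: real
  assumes "0 < p" "0 < q"
  shows "\<alpha> * (p / q) powr (\<alpha> - 1) * p + (1 - \<alpha>) * (p / q) powr \<alpha> * q = p powr \<alpha> * q powr (1 - \<alpha>)"
  using assms by (simp add: powr_divide powr_diff field_simps)

section \<open>Clipped density ratios and convergence of their tangents\<close>

text \<open>
  Phrased so that \<open>q = 0\<close> yields the upper bound \<open>n\<close>, the ratio being infinite there, and not the
  junk value \<open>p / 0 = 0\<close>.
\<close>

definition clipped_ratio :: "real \<Rightarrow> real \<Rightarrow> real \<Rightarrow> real \<Rightarrow> real" where
  "clipped_ratio l n p q = (if n * q \<le> p then n else max (p / q) l)"

lemma clipped_ratio_bounds: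
  assumes "l \<le> n" "0 \<le> n" "0 \<le> q"
  shows "l \<le> clipped_ratio l n p q" "clipped_ratio l n p q \<le> n"
proof -
  have "p / q \<le> n" if "\<not> n * q \<le> p"
  proof (cases "q = 0")
    case False
    with that assms show ?thesis by (simp add: divide_le_eq)
  qed (use assms in simp)
  then show "l \<le> clipped_ratio l n p q" "clipped_ratio l n p q \<le> n"
    using assms by (auto simp: clipped_ratio_def)
qed

text \<open>Clipping from above only lowers the ratio, and clipping from below at
  \<open>l \<le> 1\<close> raises the product to at most \<open>q\<close>. With
  \<open>clipped_ratio_ge\<close> this bounds both \<open>t q\<close> and \<open>p / t\<close> by
  \<open>max p q\<close> independently of the clipping levels, as dominated convergence
  requires.\<close>

lemma clipped_ratio_mult_le:
  assumes "0 \<le> l" "l \<le> 1" "0 \<le> p" "0 \<le> q"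
  shows "clipped_ratio l n p q * q \<le> max p q"
proof (cases "n * q \<le> p")
  case False
  have "max (p / q) l * q = max (p / q * q) (l * q)"
    using assms by (simp add: max_mult_distrib_right)
  also have "\<dots> \<le> max p q"
    using assms by (intro max.mono) (auto simp: mult_left_le_one_le)
  finally show ?thesis using False by (simp add: clipped_ratio_def)
qed (simp add: clipped_ratio_def)

text \<open>Where the ratio is cut down its value is \<open>n \<ge> 1\<close>, which suffices;
  elsewhere it is at least \<open>p / q\<close>.\<close>

lemma clipped_ratio_ge:
  assumes "0 < l" "1 \<le> n" "0 \<le> p" "0 \<le> q"
  shows "p \<le> clipped_ratio l n p q * max p q"
proof (cases "n * q \<le> p")
  case True
  have "1 * p \<le> n * max p q" using assms by (intro mult_mono) auto
  with True show ?thesis by (simp add: clipped_ratio_def)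
next
  case False
  with assms have "q \<noteq> 0" by auto
  then have "p = p / q * q" by simp
  also have "\<dots> \<le> max (p / q) l * max p q"
    using assms by (intro mult_mono) auto
  finally show ?thesis using False by (simp add: clipped_ratio_def)
qed

lemma eventually_clipped_ratio_eq:
  assumes "0 < p" "0 < q"
  shows "\<forall>\<^sub>F n in sequentially. clipped_ratio (1 / real (Suc n)) (real (Suc n)) p q = p / q"
    and "\<forall>\<^sub>F n in sequentially. clipped_ratio 0 (real (Suc n)) p q = p / q"
proof -
  have lim: "(\<lambda>n. 1 / real (Suc n)) \<longlonglongrightarrow> 0" by (rule LIMSEQ_Suc[OF lim_1_over_n])
  have "\<forall>\<^sub>F n in sequentially. 1 / real (Suc n) < q / p \<and> 1 / real (Suc n) < p / q"
    using order_tendstoD(2)[OF lim] assms by (intro eventually_conj) auto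
  then have "\<forall>\<^sub>F n in sequentially. \<not> real (Suc n) * q \<le> p \<and> 1 / real (Suc n) < p / q"
    by eventually_elim (use assms in \<open>auto simp: field_simps\<close>)
  then show "\<forall>\<^sub>F n in sequentially. clipped_ratio (1 / real (Suc n)) (real (Suc n)) p q = p / q"
    and "\<forall>\<^sub>F n in sequentially. clipped_ratio 0 (real (Suc n)) p q = p / q"
    using assms by (auto elim!: eventually_mono simp: clipped_ratio_def)
qed

text \<open>Both cutoffs matter at degenerate points. Where \<open>q = 0\<close>, the ratio is the
  upper cutoff and its negative power \<open>\<alpha> - 1\<close> tends to 0; where
  \<open>p = 0 < q\<close>, it is the lower cutoff and its power \<open>\<alpha>\<close> tends to 0.
  Where both are positive, clipping is eventually inactive and the tangent touches.\<close>

lemma tangent_clipped_tendsto_less_1: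
  fixes p q \<alpha> :: real
  assumes \<alpha>: "0 < \<alpha>" "\<alpha> < 1" and "0 \<le> p" "0 \<le> q"
  defines "t \<equiv> \<lambda>n. clipped_ratio (1 / real (Suc n)) (real (Suc n)) p q"
  shows "(\<lambda>n. \<alpha> * t n powr (\<alpha> - 1) * p + (1 - \<alpha>) * t n powr \<alpha> * q) \<longlonglongrightarrow>
    p powr \<alpha> * q powr (1 - \<alpha>)"
proof -
  have lim: "(\<lambda>n. real (Suc n) powr s) \<longlonglongrightarrow> 0" if "s < 0" for s :: real
    using tendsto_neg_powr[OF that filterlim_compose[OF filterlim_real_sequentially filterlim_Suc]] .
  consider "q = 0" | "p = 0" "0 < q" | "0 < p" "0 < q" using assms by fastforce
  then show ?thesis
  proof cases
    case 1
    then have "t n = real (Suc n)" for n using assms by (simp add: t_def clipped_ratio_def)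
    moreover have "(\<lambda>n. \<alpha> * real (Suc n) powr (\<alpha> - 1) * p) \<longlonglongrightarrow> \<alpha> * 0 * p"
      using \<alpha> by (intro tendsto_intros lim) simp
    ultimately show ?thesis using 1 \<alpha> by simp
  next
    case 2
    have "\<not> real (Suc n) * q \<le> 0" for n using 2 by (simp add: mult_le_0_iff)
    then have "t n powr \<alpha> = real (Suc n) powr (- \<alpha>)" for n
      using 2 unfolding t_def clipped_ratio_def by (simp add: powr_divide powr_minus_divide)
    moreover have "(\<lambda>n. (1 - \<alpha>) * real (Suc n) powr (- \<alpha>) * q) \<longlonglongrightarrow> (1 - \<alpha>) * 0 * q"
      using \<alpha> by (intro tendsto_intros lim) simp
    ultimately show ?thesis using 2 \<alpha> by simp
  next
    case 3
    show ?thesis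
      by (rule tendsto_eventually, rule eventually_mono[OF eventually_clipped_ratio_eq(1)[OF 3]])
        (simp add: t_def tangent_powr_eq[OF 3])
  qed
qed

text \<open>Both exponents are positive, so the lower cutoff can be 0. Where
  \<open>q = 0 < p\<close> the tangents grow without bound, in accordance with the infinite
  integrand there.\<close>

lemma tangent_clipped_tendsto_greater_1:
  fixes p q \<alpha> :: real
  assumes \<alpha>: "1 < \<alpha>" and "0 \<le> p" "0 \<le> q"
  defines "t \<equiv> \<lambda>n. clipped_ratio 0 (real (Suc n)) p q"
  shows "(\<lambda>n. ennreal (\<alpha> * t n powr (\<alpha> - 1) * p + (1 - \<alpha>) * t n powr \<alpha> * q)) \<longlonglongrightarrow>
    renyi_integrand \<alpha> p q"
proof -
  consider "p = 0" "q = 0" | "0 < p" "q = 0" | "p = 0" "0 < q" | "0 < p" "0 < q"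
    using assms by fastforce
  then show ?thesis
  proof cases
    case 1
    then show ?thesis using \<alpha> by (simp add: renyi_integrand_def)
  next
    case 2
    have t: "t n = real (Suc n)" for n using 2 by (simp add: t_def clipped_ratio_def)
    have "filterlim (\<lambda>n. real (Suc n) powr (\<alpha> - 1)) at_top sequentially"
    proof -
      have "(\<lambda>n. real (Suc n) powr (1 - \<alpha>)) \<longlonglongrightarrow> 0"
        using \<alpha> by (intro tendsto_neg_powr
            filterlim_compose[OF filterlim_real_sequentially filterlim_Suc]) simp
      then have "filterlim (\<lambda>n. inverse (real (Suc n) powr (1 - \<alpha>))) at_top sequentially"
        by (rule filterlim_inverse_at_top) simp
      then show ?thesis by (simp add: powr_minus[symmetric])
    qed
    then have "filterlim (\<lambda>n. (\<alpha> * p) * real (Suc n) powr (\<alpha> - 1)) at_top sequentially"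
      using 2 \<alpha> by (intro filterlim_tendsto_pos_mult_at_top[OF tendsto_const]) auto
    moreover have "renyi_integrand \<alpha> p q = top"
      using 2 \<alpha> by (simp add: renyi_integrand_def ennreal_divide_zero)
    ultimately show ?thesis
      using 2 by (simp add: t ennreal_tendsto_top_eq_at_top mult_ac)
  next
    case 3
    have "\<not> real (Suc n) * q \<le> 0" for n using 3 by (simp add: mult_le_0_iff)
    then have "t n = 0" for n using 3 by (simp add: t_def clipped_ratio_def)
    then show ?thesis using 3 \<alpha> by (simp add: renyi_integrand_def)
  next
    case 4
    have "renyi_integrand \<alpha> p q = ennreal (p powr \<alpha> * q powr (1 - \<alpha>))"
      using 4 \<alpha> by (simp add: renyi_integrand_def divide_ennreal powr_diff)
    then show ?thesis
      by (intro tendsto_eventually eventually_mono[OF eventually_clipped_ratio_eq(2)[OF 4]])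
        (simp add: t_def tangent_powr_eq[OF 4])
  qed
qed

text \<open>Written against \<open>P\<close> and \<open>Q\<close> themselves and not against a
  dominating measure, so that \<open>t\<close> can stay fixed while the pair varies.\<close>

definition tangent_integral :: "real \<Rightarrow> ('a \<Rightarrow> real) \<Rightarrow> 'a measure \<Rightarrow> 'a measure \<Rightarrow> real" where
  "tangent_integral \<alpha> t P Q = (\<integral>x. \<alpha> * t x powr (\<alpha> - 1) \<partial>P) + (\<integral>x. (1 - \<alpha>) * t x powr \<alpha> \<partial>Q)"

text \<open>Both coefficients of the tangent are to be bounded, so that their integrals are setwise
  continuous. Positivity for \<open>\<alpha> < 1\<close> excludes \<open>t x = 0\<close>, where the
  convention \<open>0 powr s = 0\<close> would break the tangent inequality.\<close>

definition bounded_slope :: "real \<Rightarrow> 'a measure \<Rightarrow> ('a \<Rightarrow> real) \<Rightarrow> bool" where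
  "bounded_slope \<alpha> M t \<longleftrightarrow> t \<in> borel_measurable M \<and>
     (\<exists>B. \<forall>x. 0 \<le> t x \<and> t x powr (\<alpha> - 1) \<le> B \<and> t x powr \<alpha> \<le> B) \<and> (\<alpha> < 1 \<longrightarrow> (\<forall>x. 0 < t x))"

lemma continuous_map_tangent_integral:
  assumes "bounded_slope \<alpha> M t"
  shows "continuous_map (prod_topology (setwise_topology M) (setwise_topology M)) euclideanreal
    (\<lambda>z. tangent_integral \<alpha> t (fst z) (snd z))"
proof -
  obtain B where B: "\<And>x. t x powr (\<alpha> - 1) \<le> B" "\<And>x. t x powr \<alpha> \<le> B"
    and [measurable]: "t \<in> borel_measurable M"
    using assms by (auto simp: bounded_slope_def)
  have "continuous_map (setwise_topology M) euclideanreal (\<lambda>P. \<integral>x. \<alpha> * t x powr (\<alpha> - 1) \<partial>P)"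
    by (rule continuous_map_setwise_integral[where B="\<bar>\<alpha>\<bar> * B"])
      (auto simp: abs_mult intro!: mult_left_mono B)
  moreover have "continuous_map (setwise_topology M) euclideanreal (\<lambda>Q. \<integral>x. (1 - \<alpha>) * t x powr \<alpha> \<partial>Q)"
    by (rule continuous_map_setwise_integral[where B="\<bar>1 - \<alpha>\<bar> * B"])
      (auto simp: abs_mult intro!: mult_left_mono B)
  ultimately show ?thesis
    unfolding tangent_integral_def
    by (intro continuous_map_add continuous_map_compose[OF continuous_map_fst, unfolded comp_def]
        continuous_map_compose[OF continuous_map_snd, unfolded comp_def])
qed

context prob_space_pair
begin

lemma integrable_densities:
  "integrable \<mu> p" "integrable \<mu> q"
proof -
  have "emeasure (density \<mu> (\<lambda>x. ennreal (q x))) (space P) = (\<integral>\<^sup>+x. ennreal (q x) \<partial>\<mu>)"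
    by (subst emeasure_density) (auto intro!: nn_integral_cong)
  then have "(\<integral>\<^sup>+x. ennreal (q x) \<partial>\<mu>) < \<infinity>" 
    by (metis density_q Q.emeasure_finite infinity_ennreal_def less_top)
  then show "integrable \<mu> p" "integrable \<mu> q"
    by (simp_all add: integrable_iff_bounded nn_integral_p)
qed

lemma integral_density_bounded:
  fixes u :: "'a \<Rightarrow> real"
  assumes [measurable]: "u \<in> borel_measurable P" and B: "\<And>x. \<bar>u x\<bar> \<le> B"
  shows "integrable \<mu> (\<lambda>x. p x * u x)" "(\<integral>x. u x \<partial>P) = (\<integral>x. p x * u x \<partial>\<mu>)"
    and "integrable \<mu> (\<lambda>x. q x * u x)" "(\<integral>x. u x \<partial>Q) = (\<integral>x. q x * u x \<partial>\<mu>)"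
proof -
  have "integrable \<mu> (\<lambda>x. f x * u x)" if f: "integrable \<mu> f"
    and [measurable]: "f \<in> borel_measurable P" for f
    using f by (rule Bochner_Integration.integrable_bound[OF integrable_mult_right[where c = B]])
      (auto simp: abs_mult mult.commute[of B] intro!: AE_I2 mult_left_mono order_trans[OF B])
  then show "integrable \<mu> (\<lambda>x. p x * u x)" "integrable \<mu> (\<lambda>x. q x * u x)"
    using integrable_densities measurable_densities by blast+
  show "(\<integral>x. u x \<partial>P) = (\<integral>x. p x * u x \<partial>\<mu>)"
    by (subst density_p[symmetric]) (simp add: integral_density)
  show "(\<integral>x. u x \<partial>Q) = (\<integral>x. q x * u x \<partial>\<mu>)"
    by (subst density_q[symmetric]) (simp add: integral_density)
qed

text \<open>Over a common dominating measure the two integrals merge into one, to which pointwise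
  tangent inequalities apply.\<close>

lemma tangent_integral_eq:
  assumes "bounded_slope \<alpha> P t"
  shows "integrable \<mu> (\<lambda>x. \<alpha> * t x powr (\<alpha> - 1) * p x + (1 - \<alpha>) * t x powr \<alpha> * q x)"
    and "tangent_integral \<alpha> t P Q =
      (\<integral>x. \<alpha> * t x powr (\<alpha> - 1) * p x + (1 - \<alpha>) * t x powr \<alpha> * q x \<partial>\<mu>)"
proof -
  obtain B where B: "\<And>x. t x powr (\<alpha> - 1) \<le> B" "\<And>x. t x powr \<alpha> \<le> B"
    and t [measurable]: "t \<in> borel_measurable P"
    using assms by (auto simp: bounded_slope_def)
  have B1: "\<bar>\<alpha> * t x powr (\<alpha> - 1)\<bar> \<le> \<bar>\<alpha>\<bar> * B" for x
    using mult_left_mono[OF B(1), of "\<bar>\<alpha>\<bar>"] by (simp add: abs_mult)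
  have B2: "\<bar>(1 - \<alpha>) * t x powr \<alpha>\<bar> \<le> \<bar>1 - \<alpha>\<bar> * B" for x
    using mult_left_mono[OF B(2), of "\<bar>1 - \<alpha>\<bar>"] by (simp add: abs_mult)
  note 1 = integral_density_bounded(1,2)[OF _ B1]
  note 2 = integral_density_bounded(3,4)[OF _ B2]
  show "integrable \<mu> (\<lambda>x. \<alpha> * t x powr (\<alpha> - 1) * p x + (1 - \<alpha>) * t x powr \<alpha> * q x)"
    using 1(1) 2(1) by (simp add: mult.commute)
  show "tangent_integral \<alpha> t P Q =
      (\<integral>x. \<alpha> * t x powr (\<alpha> - 1) * p x + (1 - \<alpha>) * t x powr \<alpha> * q x \<partial>\<mu>)"
    unfolding tangent_integral_def using 1 2 by (simp add: mult.commute)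
qed

lemma renyi_integral_le_tangent:
  assumes \<alpha>: "0 < \<alpha>" "\<alpha> < 1" and t: "bounded_slope \<alpha> P t"
  shows "renyi_integral \<alpha> P Q \<le> ennreal (tangent_integral \<alpha> t P Q)"
proof -
  let ?l = "\<lambda>x. \<alpha> * t x powr (\<alpha> - 1) * p x + (1 - \<alpha>) * t x powr \<alpha> * q x"
  have pos: "0 < t x" for x using t \<alpha> by (simp add: bounded_slope_def)
  have "renyi_integrand \<alpha> (p x) (q x) \<le> ennreal (?l x)" for x
    using powr_interpolate_le[OF \<alpha>, of "p x" "q x" "t x"] pos \<alpha>
    by (simp add: renyi_integrand_def ennreal_mult[symmetric] ennreal_leI del: ennreal_plus)
  then have "renyi_integral \<alpha> P Q \<le> (\<integral>\<^sup>+x. ennreal (?l x) \<partial>\<mu>)"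
    unfolding renyi_integral_eq by (intro nn_integral_mono)
  also have "\<dots> = ennreal (\<integral>x. ?l x \<partial>\<mu>)"
    using tangent_integral_eq(1)[OF t] \<alpha> by (intro nn_integral_eq_integral) auto
  finally show ?thesis by (simp add: tangent_integral_eq(2)[OF t])
qed

lemma tangent_le_renyi_integral:
  assumes \<alpha>: "1 < \<alpha>" and t: "bounded_slope \<alpha> P t"
  shows "ennreal (tangent_integral \<alpha> t P Q) \<le> renyi_integral \<alpha> P Q"
proof -
  let ?l = "\<lambda>x. \<alpha> * t x powr (\<alpha> - 1) * p x + (1 - \<alpha>) * t x powr \<alpha> * q x"
  have t_nonneg: "0 \<le> t x" for x using t by (auto simp: bounded_slope_def)
  have le: "ennreal (?l x) \<le> renyi_integrand \<alpha> (p x) (q x)" for x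
  proof (cases "q x = 0")
    case True
    then show ?thesis
    proof (cases "p x = 0")
      case False
      then have "renyi_integrand \<alpha> (p x) (q x) = top"
        using True \<alpha> by (simp add: renyi_integrand_def ennreal_divide_zero less_le)
      then show ?thesis by simp
    qed simp
  next
    case False
    then have "0 < q x" by (simp add: less_le)
    then show ?thesis using powr_extrapolate_ge[OF \<alpha>, of "p x" "q x" "t x"] t_nonneg \<alpha>
      by (simp add: renyi_integrand_def divide_ennreal ennreal_leI)
  qed
  have int: "integrable \<mu> ?l" by (rule tangent_integral_eq(1)[OF t])
  \<comment> \<open>For \<open>\<alpha> > 1\<close> the tangent may be negative. Its positive part
    has the larger integral and still lies below the nonnegative integrand.\<close>
  have "(\<integral>x. ?l x \<partial>\<mu>) \<le> (\<integral>x. max 0 (?l x) \<partial>\<mu>)"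
    using int by (intro integral_mono integrable_max) auto
  then have "ennreal (\<integral>x. ?l x \<partial>\<mu>) \<le> ennreal (\<integral>x. max 0 (?l x) \<partial>\<mu>)" by (rule ennreal_leI)
  also have "\<dots> = (\<integral>\<^sup>+x. ennreal (max 0 (?l x)) \<partial>\<mu>)"
    using int by (intro nn_integral_eq_integral[symmetric] integrable_max) auto
  also have "\<dots> \<le> renyi_integral \<alpha> P Q"
    unfolding renyi_integral_eq using le by (intro nn_integral_mono) (simp add: max_def)
  finally show ?thesis by (simp add: tangent_integral_eq(2)[OF t])
qed

text \<open>The tangents at the clipped ratios converge pointwise to the integrand under an
  integrable majorant. By dominated convergence their integrals converge, and so eventually drop
  below \<open>c\<close>.\<close>

lemma ex_tangent_less:
  assumes \<alpha>: "0 < \<alpha>" "\<alpha> < 1" and c: "renyi_integral \<alpha> P Q < c"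
  shows "\<exists>t. bounded_slope \<alpha> P t \<and> ennreal (tangent_integral \<alpha> t P Q) < c"
proof -
  define t where "t n x = clipped_ratio (1 / real (Suc n)) (real (Suc n)) (p x) (q x)" for n x
  let ?l = "\<lambda>n x. \<alpha> * t n x powr (\<alpha> - 1) * p x + (1 - \<alpha>) * t n x powr \<alpha> * q x"
  have [measurable]: "t n \<in> borel_measurable P" for n
    unfolding t_def clipped_ratio_def by measurable
  have lower: "1 / real (Suc n) \<le> t n x" and upper: "t n x \<le> real (Suc n)" for n x
    unfolding t_def by (rule clipped_ratio_bounds; simp add: field_simps)+
  have pos: "0 < t n x" for n x using lower[of n x] by (rule less_le_trans[rotated]) simp
  \<comment> \<open>The negative exponent \<open>\<alpha> - 1\<close> is controlled by the lower
    cutoff, the positive exponent \<open>\<alpha>\<close> by the upper one.\<close>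
  have slope: "bounded_slope \<alpha> P (t n)" for n
    unfolding bounded_slope_def
  proof (intro conjI exI[of _ "max ((1 / real (Suc n)) powr (\<alpha> - 1)) (real (Suc n) powr \<alpha>)"] allI impI)
    fix x
    have "t n x powr (\<alpha> - 1) \<le> (1 / real (Suc n)) powr (\<alpha> - 1)"
      using \<alpha> lower by (intro powr_mono2') auto
    then show "t n x powr (\<alpha> - 1) \<le> max ((1 / real (Suc n)) powr (\<alpha> - 1)) (real (Suc n) powr \<alpha>)"
      by simp
    have "t n x powr \<alpha> \<le> real (Suc n) powr \<alpha>"
      using \<alpha> upper pos by (intro powr_mono2) (auto simp: less_imp_le)
    then show "t n x powr \<alpha> \<le> max ((1 / real (Suc n)) powr (\<alpha> - 1)) (real (Suc n) powr \<alpha>)"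
      by simp
  qed (use pos in \<open>auto simp: less_imp_le\<close>)
  \<comment> \<open>Since \<open>s powr \<beta> \<le> s + 1\<close>, a bound on \<open>s * y\<close>
    yields one on \<open>s powr \<beta> * y\<close>. It is used for \<open>t\<close> with exponent
    \<open>\<alpha>\<close> and for \<open>inverse t\<close> with exponent
    \<open>1 - \<alpha>\<close>.\<close>
  have powr_le: "s powr \<beta> * y \<le> r + y" if "0 < s" "0 < \<beta>" "\<beta> < 1" "0 \<le> y" "s * y \<le> r" "0 \<le> r"
    for s \<beta> y r :: real
  proof -
    have "s powr \<beta> \<le> s + 1"
      using powr_interpolate_le[of \<beta> s 1 1] that by simp (smt (verit) mult_left_le_one_le)
    then have "s powr \<beta> * y \<le> (s + 1) * y" using that by (intro mult_right_mono) auto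
    then show ?thesis using that by (simp add: algebra_simps)
  qed
  \<comment> \<open>Each power term is at most \<open>max p q\<close> plus one of the densities,
    hence at most \<open>2 * (p + q)\<close>; the weights \<open>\<alpha>\<close> and
    \<open>1 - \<alpha>\<close> add up to 1.\<close>
  have bound: "norm (?l n x) \<le> 2 * (p x + q x)" for n x
  proof -
    have max_le: "max (p x) (q x) + p x \<le> 2 * (p x + q x)" "max (p x) (q x) + q x \<le> 2 * (p x + q x)"
      by (cases "p x \<le> q x"; simp add: max_def add_increasing add_increasing2)+
    have "t n x * q x \<le> max (p x) (q x)"
      unfolding t_def by (rule clipped_ratio_mult_le) auto
    then have "t n x powr \<alpha> * q x \<le> max (p x) (q x) + q x"
      using \<alpha> pos by (intro powr_le) (auto simp: le_max_iff_disj)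
    then have 1: "(1 - \<alpha>) * (t n x powr \<alpha> * q x) \<le> (1 - \<alpha>) * (2 * (p x + q x))"
      using \<alpha> max_le by (intro mult_left_mono) linarith+
    have "p x \<le> t n x * max (p x) (q x)"
      unfolding t_def by (rule clipped_ratio_ge) auto
    then have "inverse (t n x) * p x \<le> max (p x) (q x)"
      using pos[of n x] by (simp add: field_simps)
    then have "inverse (t n x) powr (1 - \<alpha>) * p x \<le> max (p x) (q x) + p x"
      using \<alpha> pos by (intro powr_le) (auto simp: le_max_iff_disj)
    moreover have "inverse (t n x) powr (1 - \<alpha>) = t n x powr (\<alpha> - 1)"
      using pos[of n x] powr_minus[of "t n x" "1 - \<alpha>"]
      by (simp add: inverse_eq_divide powr_divide)
    ultimately have "t n x powr (\<alpha> - 1) * p x \<le> max (p x) (q x) + p x" by simp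
    then have 2: "\<alpha> * (t n x powr (\<alpha> - 1) * p x) \<le> \<alpha> * (2 * (p x + q x))"
      using \<alpha> max_le by (intro mult_left_mono) linarith+
    have "0 \<le> ?l n x" using \<alpha> by simp
    moreover have "?l n x \<le> \<alpha> * (2 * (p x + q x)) + (1 - \<alpha>) * (2 * (p x + q x))"
      using 1 2 by (simp only: mult.assoc add_mono)
    ultimately show ?thesis by (simp add: algebra_simps)
  qed
  have lim: "(\<lambda>n. ?l n x) \<longlonglongrightarrow> p x powr \<alpha> * q x powr (1 - \<alpha>)" for x
    unfolding t_def by (rule tangent_clipped_tendsto_less_1[OF \<alpha>]) auto
  have dom: "integrable \<mu> (\<lambda>x. 2 * (p x + q x))"
    using integrable_densities by simp
  have meas: "?l n \<in> borel_measurable \<mu>" "(\<lambda>x. p x powr \<alpha> * q x powr (1 - \<alpha>)) \<in> borel_measurable \<mu>" for n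
    by measurable
  note dc = integrable_dominated_convergence[where s="?l", OF meas(2,1) dom]
    integral_dominated_convergence[where s="?l", OF meas(2,1) dom]
  have "(\<lambda>n. tangent_integral \<alpha> (t n) P Q) \<longlonglongrightarrow> (\<integral>x. p x powr \<alpha> * q x powr (1 - \<alpha>) \<partial>\<mu>)"
    unfolding tangent_integral_eq(2)[OF slope] by (rule dc(2)) (use lim bound in auto)
  then have "(\<lambda>n. ennreal (tangent_integral \<alpha> (t n) P Q)) \<longlonglongrightarrow>
      ennreal (\<integral>x. p x powr \<alpha> * q x powr (1 - \<alpha>) \<partial>\<mu>)"
    by (rule tendsto_ennrealI)
  also have "ennreal (\<integral>x. p x powr \<alpha> * q x powr (1 - \<alpha>) \<partial>\<mu>) =
      (\<integral>\<^sup>+x. ennreal (p x powr \<alpha> * q x powr (1 - \<alpha>)) \<partial>\<mu>)"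
    by (rule nn_integral_eq_integral[symmetric], rule dc(1)) (use lim bound in auto)
  also have "\<dots> = renyi_integral \<alpha> P Q"
    unfolding renyi_integral_eq using \<alpha> by (simp add: renyi_integrand_def ennreal_mult)
  finally have "\<forall>\<^sub>F n in sequentially. ennreal (tangent_integral \<alpha> (t n) P Q) < c"
    using c by (rule order_tendstoD)
  then show ?thesis using slope eventually_happens'[OF sequentially_bot] by blast
qed

text \<open>The integral may be infinite, so there need be no integrable majorant. Fatou's lemma
  gives the one inequality required, because the tangents at the clipped ratios are
  nonnegative.\<close>

lemma ex_less_tangent:
  assumes \<alpha>: "1 < \<alpha>" and c: "c < renyi_integral \<alpha> P Q"
  shows "\<exists>t. bounded_slope \<alpha> P t \<and> c < ennreal (tangent_integral \<alpha> t P Q)"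
proof -
  define t where "t n x = clipped_ratio 0 (real (Suc n)) (p x) (q x)" for n x
  let ?l = "\<lambda>n x. \<alpha> * t n x powr (\<alpha> - 1) * p x + (1 - \<alpha>) * t n x powr \<alpha> * q x"
  have [measurable]: "t n \<in> borel_measurable P" for n
    unfolding t_def clipped_ratio_def by measurable
  have lower: "0 \<le> t n x" and upper: "t n x \<le> real (Suc n)" for n x
    unfolding t_def by (rule clipped_ratio_bounds; simp)+
  \<comment> \<open>As \<open>real (Suc n)\<close> is at least 1, its power with the larger exponent
    \<open>\<alpha>\<close> bounds both coefficients.\<close>
  have slope: "bounded_slope \<alpha> P (t n)" for n
    unfolding bounded_slope_def
  proof (intro conjI exI[of _ "real (Suc n) powr \<alpha>"] allI impI)
    fix x
    show "t n x powr \<alpha> \<le> real (Suc n) powr \<alpha>"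
      using \<alpha> lower upper by (intro powr_mono2) auto
    have "t n x powr (\<alpha> - 1) \<le> real (Suc n) powr (\<alpha> - 1)"
      using \<alpha> lower upper by (intro powr_mono2) auto
    also have "\<dots> \<le> real (Suc n) powr \<alpha>" by (intro powr_mono) auto
    finally show "t n x powr (\<alpha> - 1) \<le> real (Suc n) powr \<alpha>" .
  qed (use lower \<alpha> in auto)
  \<comment> \<open>With lower cutoff 0, clipping never raises the ratio, so
    \<open>t q \<le> p\<close>. Factoring out \<open>t powr (\<alpha> - 1)\<close> then leaves a
    nonnegative expression.\<close>
  have nonneg_l: "0 \<le> ?l n x" for n x
  proof -
    have le: "t n x * q x \<le> p x"
    proof (cases "real (Suc n) * q x \<le> p x")
      case False
      then have "0 < q x" using nonneg[of x] by (cases "q x = 0") (auto simp: less_le)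
      then show ?thesis using False by (simp add: t_def clipped_ratio_def max_def)
    qed (simp add: t_def clipped_ratio_def)
    have "t n x powr \<alpha> = t n x powr (\<alpha> - 1) * t n x"
      using \<alpha> powr_add[of "t n x" "\<alpha> - 1" 1] lower[of n x] by simp
    then have "?l n x = t n x powr (\<alpha> - 1) * (p x + (\<alpha> - 1) * (p x - t n x * q x))"
      by (simp add: algebra_simps)
    then show ?thesis using \<alpha> le by simp
  qed
  have "renyi_integral \<alpha> P Q = (\<integral>\<^sup>+x. liminf (\<lambda>n. ennreal (?l n x)) \<partial>\<mu>)"
    unfolding renyi_integral_eq t_def
    by (intro nn_integral_cong lim_imp_Liminf[symmetric] tangent_clipped_tendsto_greater_1 \<alpha>) auto
  also have "\<dots> \<le> liminf (\<lambda>n. \<integral>\<^sup>+x. ennreal (?l n x) \<partial>\<mu>)"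
    by (intro nn_integral_liminf) measurable
  also have "(\<lambda>n. \<integral>\<^sup>+x. ennreal (?l n x) \<partial>\<mu>) = (\<lambda>n. ennreal (tangent_integral \<alpha> (t n) P Q))"
    unfolding tangent_integral_eq(2)[OF slope]
    by (intro ext nn_integral_eq_integral tangent_integral_eq(1)[OF slope] AE_I2 nonneg_l)
  finally have "c < liminf (\<lambda>n. ennreal (tangent_integral \<alpha> (t n) P Q))" using c by simp
  then have "\<forall>\<^sub>F n in sequentially. c < ennreal (tangent_integral \<alpha> (t n) P Q)"
    by (rule less_LiminfD)
  then show ?thesis using slope eventually_happens'[OF sequentially_bot] by blast
qed

end

section \<open>Lower semicontinuity\<close>

lemma prob_space_pair_topspace:
  assumes "z \<in> topspace (prod_topology (setwise_topology M) (setwise_topology M))"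
  shows "prob_space_pair (fst z) (snd z)" "sets (fst z) = sets M"
  using assms by (auto simp: space_prob_algebra prob_space_pair_def prob_space_pair_axioms_def)

lemma bounded_slope_cong_sets: "sets N = sets M \<Longrightarrow> bounded_slope \<alpha> N = bounded_slope \<alpha> M"
  by (simp add: bounded_slope_def fun_eq_iff cong: measurable_cong_sets)

text \<open>The integral is an infimum of continuous tangent functionals, so its strict sublevel set
  is a union of open preimages. Admissibility of \<open>t\<close> depends only on the measurable
  sets, so one family serves all pairs.\<close>

lemma openin_renyi_integral_less:
  fixes M :: "'a measure"
  assumes \<alpha>: "0 < \<alpha>" "\<alpha> < 1"
  defines "X \<equiv> prod_topology (setwise_topology M) (setwise_topology M)"
  shows "openin X {z \<in> topspace X. renyi_integral \<alpha> (fst z) (snd z) < c}"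
proof -
  let ?U = "\<lambda>t. {z \<in> topspace X. tangent_integral \<alpha> t (fst z) (snd z) \<in> ennreal -` {..<c}}"
  have eq: "{z \<in> topspace X. renyi_integral \<alpha> (fst z) (snd z) < c} = \<Union> (?U ` Collect (bounded_slope \<alpha> M))"
  proof (intro equalityI subsetI)
    fix z assume z: "z \<in> {z \<in> topspace X. renyi_integral \<alpha> (fst z) (snd z) < c}"
    then interpret prob_space_pair "fst z" "snd z" using prob_space_pair_topspace X_def by blast
    show "z \<in> \<Union> (?U ` Collect (bounded_slope \<alpha> M))"
      using ex_tangent_less[OF \<alpha>, of c] z bounded_slope_cong_sets[of "fst z" M]
        prob_space_pair_topspace(2)[of z M]
      by (auto simp: X_def)
  next
    fix z assume "z \<in> \<Union> (?U ` Collect (bounded_slope \<alpha> M))"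
    then obtain t where z: "z \<in> topspace X" "ennreal (tangent_integral \<alpha> t (fst z) (snd z)) < c"
      and t: "bounded_slope \<alpha> M t" by auto
    from z(1) interpret prob_space_pair "fst z" "snd z" using prob_space_pair_topspace X_def by blast
    have "bounded_slope \<alpha> (fst z) t"
      using t bounded_slope_cong_sets prob_space_pair_topspace(2) z(1) unfolding X_def by metis
    then show "z \<in> {z \<in> topspace X. renyi_integral \<alpha> (fst z) (snd z) < c}"
      using renyi_integral_le_tangent[OF \<alpha>, of t] z by auto
  qed
  have S: "open (ennreal -` {..<c})"
    by (intro open_vimage open_lessThan continuous_on_ennreal continuous_on_id)
  have "openin X (?U t)" if "bounded_slope \<alpha> M t" for t
    unfolding X_def using S
    by (intro openin_continuous_map_preimage[OF continuous_map_tangent_integral[OF that]]) simp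
  then show ?thesis unfolding eq by (intro openin_Union) blast
qed

text \<open>For \<open>\<alpha> > 1\<close> the integral is a supremum of the tangent functionals,
  so its strict superlevel set is the union of theirs.\<close>

lemma openin_less_renyi_integral:
  fixes M :: "'a measure"
  assumes \<alpha>: "1 < \<alpha>"
  defines "X \<equiv> prod_topology (setwise_topology M) (setwise_topology M)"
  shows "openin X {z \<in> topspace X. c < renyi_integral \<alpha> (fst z) (snd z)}"
proof -
  let ?U = "\<lambda>t. {z \<in> topspace X. tangent_integral \<alpha> t (fst z) (snd z) \<in> ennreal -` {c<..}}"
  have eq: "{z \<in> topspace X. c < renyi_integral \<alpha> (fst z) (snd z)} = \<Union> (?U ` Collect (bounded_slope \<alpha> M))"
  proof (intro equalityI subsetI)
    fix z assume z: "z \<in> {z \<in> topspace X. c < renyi_integral \<alpha> (fst z) (snd z)}"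
    then interpret prob_space_pair "fst z" "snd z" using prob_space_pair_topspace X_def by blast
    show "z \<in> \<Union> (?U ` Collect (bounded_slope \<alpha> M))"
      using ex_less_tangent[OF \<alpha>, of c] z bounded_slope_cong_sets[of "fst z" M]
        prob_space_pair_topspace(2)[of z M]
      by (auto simp: X_def)
  next
    fix z assume "z \<in> \<Union> (?U ` Collect (bounded_slope \<alpha> M))"
    then obtain t where z: "z \<in> topspace X" "c < ennreal (tangent_integral \<alpha> t (fst z) (snd z))"
      and t: "bounded_slope \<alpha> M t" by auto
    from z(1) interpret prob_space_pair "fst z" "snd z" using prob_space_pair_topspace X_def by blast
    have "bounded_slope \<alpha> (fst z) t"
      using t bounded_slope_cong_sets prob_space_pair_topspace(2) z(1) unfolding X_def by metis
    then show "z \<in> {z \<in> topspace X. c < renyi_integral \<alpha> (fst z) (snd z)}"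
      using tangent_le_renyi_integral[OF \<alpha>, of t] z by auto
  qed
  have S: "open (ennreal -` {c<..})"
    by (intro open_vimage open_greaterThan continuous_on_ennreal continuous_on_id)
  have "openin X (?U t)" if "bounded_slope \<alpha> M t" for t
    unfolding X_def using S
    by (intro openin_continuous_map_preimage[OF continuous_map_tangent_integral[OF that]]) simp
  then show ?thesis unfolding eq by (intro openin_Union) blast
qed

text \<open>For \<open>\<alpha> < 1\<close> the factor \<open>1 / (\<alpha> - 1)\<close> is
  negative, so a superlevel set of the divergence is a sublevel set of the integral; for
  \<open>\<alpha> > 1\<close> it is a superlevel set. The threshold \<open>c\<close> carries the
  comparison through the logarithm.\<close>

lemma lower_semicontinuous_renyi_simple:
  fixes M :: "'a measure"
  assumes \<alpha>: "0 < \<alpha>" "\<alpha> \<noteq> 1"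
  shows "lower_semicontinuous_map (prod_topology (setwise_topology M) (setwise_topology M))
    (\<lambda>z. renyi_simple \<alpha> (fst z) (snd z))"
  unfolding lower_semicontinuous_map_def
proof
  fix a :: ereal
  let ?X = "prod_topology (setwise_topology M) (setwise_topology M)"
  show "openin ?X {z \<in> topspace ?X. a < renyi_simple \<alpha> (fst z) (snd z)}"
  proof (cases "\<alpha> < 1")
    case True
    obtain c where c: "\<And>x. ln_ext x < a * ereal (\<alpha> - 1) \<longleftrightarrow> x < c" using ln_ext_less_iff by metis
    have "a < ereal (1 / (\<alpha> - 1)) * y \<longleftrightarrow> y < a * ereal (\<alpha> - 1)" for y
      using True by (cases a; cases y) (auto simp: field_simps)
    then show ?thesis
      unfolding renyi_simple_eq c by (simp only: c openin_renyi_integral_less[OF \<alpha>(1) True])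
  next
    case False
    with \<alpha> have 1: "1 < \<alpha>" by simp
    obtain c where c: "\<And>x. a * ereal (\<alpha> - 1) < ln_ext x \<longleftrightarrow> c < x" using ln_ext_less_iff by metis
    have "a < ereal (1 / (\<alpha> - 1)) * y \<longleftrightarrow> a * ereal (\<alpha> - 1) < y" for y
      using 1 by (cases a; cases y) (auto simp: field_simps)
    then show ?thesis
      unfolding renyi_simple_eq by (simp only: c openin_less_renyi_integral[OF 1])
  qed
qed

section \<open>Suprema of simple orders and the extended orders\<close>

lemma lower_semicontinuous_map_cong:
  assumes "\<And>x. x \<in> topspace X \<Longrightarrow> f x = g x"
  shows "lower_semicontinuous_map X f \<longleftrightarrow> lower_semicontinuous_map X g"
proof -
  have "{x \<in> topspace X. a < f x} = {x \<in> topspace X. a < g x}" for a using assms by auto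
  then show ?thesis by (simp add: lower_semicontinuous_map_def)
qed

lemma lower_semicontinuous_map_SUP:
  assumes "\<And>i. i \<in> I \<Longrightarrow> lower_semicontinuous_map X (f i)"
  shows "lower_semicontinuous_map X (\<lambda>x. SUP i\<in>I. f i x)"
  unfolding lower_semicontinuous_map_def
proof
  fix a
  have "{x \<in> topspace X. a < (SUP i\<in>I. f i x)} = (\<Union>i\<in>I. {x \<in> topspace X. a < f i x})"
    by (auto simp: less_SUP_iff)
  then show "openin X {x \<in> topspace X. a < (SUP i\<in>I. f i x)}"
    using assms by (auto simp: lower_semicontinuous_map_def intro!: openin_Union)
qed

text \<open>Monotonicity on the orders below 1 makes the left limit exist and equal the
  supremum.\<close>

lemma (in prob_space_pair) renyi_divergence_1:
  "renyi_divergence 1 P Q = (SUP a\<in>{0<..<1}. renyi_simple a P Q)"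
proof -
  have "((\<lambda>a. renyi_simple a P Q) \<longlongrightarrow> (SUP a\<in>{0<..<1}. renyi_simple a P Q)) (at_left 1)"
  proof (rule increasing_tendsto)
    show "\<forall>\<^sub>F a in at_left 1. renyi_simple a P Q \<le> (SUP a\<in>{0<..<1}. renyi_simple a P Q)"
      using eventually_at_left_real[of 0 "1::real"] by (auto elim!: eventually_mono intro: SUP_upper)
    fix y assume "y < (SUP a\<in>{0<..<1}. renyi_simple a P Q)"
    then obtain b where b: "0 < b" "b < 1" "y < renyi_simple b P Q" by (auto simp: less_SUP_iff)
    show "\<forall>\<^sub>F a in at_left 1. y < renyi_simple a P Q"
      using eventually_at_left_real[OF b(2)]
      by eventually_elim (use b renyi_simple_mono_less_1[of b] in \<open>fastforce intro: less_le_trans\<close>)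
  qed
  then show ?thesis by (simp add: renyi_divergence_def tendsto_Lim)
qed

text \<open>The limit sees only large orders, so monotonicity above 1 suffices and no comparison
  across order 1 is made.\<close>

lemma (in prob_space_pair) renyi_divergence_infinity:
  "renyi_divergence \<infinity> P Q = (SUP a\<in>{1<..}. renyi_simple a P Q)"
proof -
  have "((\<lambda>a. renyi_simple a P Q) \<longlongrightarrow> (SUP a\<in>{1<..}. renyi_simple a P Q)) at_top"
  proof (rule increasing_tendsto)
    show "\<forall>\<^sub>F a in at_top. renyi_simple a P Q \<le> (SUP a\<in>{1<..}. renyi_simple a P Q)"
      using eventually_gt_at_top[of "1::real"] by eventually_elim (auto intro!: SUP_upper)
    fix y assume "y < (SUP a\<in>{1<..}. renyi_simple a P Q)"
    then obtain b where b: "1 < b" "y < renyi_simple b P Q" by (auto simp: less_SUP_iff)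
    show "\<forall>\<^sub>F a in at_top. y < renyi_simple a P Q"
      using eventually_ge_at_top[of b]
      by eventually_elim (use b renyi_simple_mono_greater_1[of b] in \<open>fastforce intro: less_le_trans\<close>)
  qed
  then show ?thesis by (simp add: renyi_divergence_def tendsto_Lim)
qed

theorem theorem15:
  fixes M :: "'a measure" and \<alpha> :: ereal
  assumes "0 < \<alpha>"
  shows "lower_semicontinuous_map
           (prod_topology (setwise_topology M) (setwise_topology M))
           (\<lambda>(P, Q). renyi_divergence \<alpha> P Q)"
proof -
  let ?X = "prod_topology (setwise_topology M) (setwise_topology M)"
  \<comment> \<open>All three kinds of order reduce to a supremum of simple orders; a finite order
    \<open>r \<noteq> 1\<close> is the supremum over \<open>{r}\<close>.\<close>
  have SUP: ?thesis
    if "I \<subseteq> {0<..} - {1}"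
      and sup: "\<And>P Q :: 'a measure. prob_space_pair P Q \<Longrightarrow>
        renyi_divergence \<alpha> P Q = (SUP a\<in>I. renyi_simple a P Q)" for I
  proof -
    have "lower_semicontinuous_map ?X (\<lambda>z. SUP a\<in>I. renyi_simple a (fst z) (snd z))"
      using that(1) by (intro lower_semicontinuous_map_SUP lower_semicontinuous_renyi_simple) auto
    moreover have "renyi_divergence \<alpha> (fst z) (snd z) = (SUP a\<in>I. renyi_simple a (fst z) (snd z))"
      if "z \<in> topspace ?X" for z
      using sup prob_space_pair_topspace(1)[OF that] by blast
    ultimately show ?thesis
      unfolding case_prod_beta by (subst lower_semicontinuous_map_cong)
  qed
  consider "\<alpha> = 1" | "\<alpha> = \<infinity>" | r where "\<alpha> = ereal r" "0 < r" "r \<noteq> 1"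
    using assms by (cases \<alpha>) auto
  then show ?thesis
  proof cases
    case 1
    then show ?thesis
      by (intro SUP[of "{0<..<1}"]) (auto simp: prob_space_pair.renyi_divergence_1)
  next
    case 2
    then show ?thesis
      by (intro SUP[of "{1<..}"]) (auto simp: prob_space_pair.renyi_divergence_infinity)
  next
    case 3
    then show ?thesis by (intro SUP[of "{r}"]) (auto simp: renyi_divergence_def)
  qed
qed

end
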